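(* Let $F:\mathcal{A}\to\mathcal{C}$ be a form such that $f.A$ and $B.f$ exist for every $\mathcal{C}$-morphism $f:X\to Y$, $A\in F^{-1}X$, $B\in F^{-1}Y$, and such that every fibre $F^{-1}X$ is a complete lattice (under $\leq_X$). For an interior operator $I$ on $F$ define $\sqsubset^{I}$ by $A\sqsubset^{I}_{X}B\Leftrightarrow A\leq_X I_X(B)$, and for a topogenous order $\sqsubset$ on $F$ satisfying $(TJ)$ define $I^{\sqsubset}$ by $I^{\sqsubset}_X(B)=\bigvee\{A\in F^{-1}X\mid A\sqsubset_X B\}$, for all $X\in\mathcal{C}$ and $A,B\in F^{-1}X$. Then the assignments $I\mapsto\sqsubset^{I}$ and $\sqsubset\mapsto I^{\sqsubset}$ define order isomorphisms, inverse to each other, between $\mathrm{Int}(F)$ and $\mathrm{JTORD}(F)$. Moreover, for $\sqsubset\in\mathrm{JTORD}(F)$, $I^{\sqsubset}$ is idempotent if and only if $\sqsubset$ is interpolative.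
   Context: A form over a category $\mathcal{C}$ is a functor $F:\mathcal{A}\to\mathcal{C}$ that is faithful and amnestic (an isomorphism $h:A\to B$ in $\mathcal{A}$ with $Fh=1_{FA}$ satisfies $A=B$, $h=1_A$). The fibre $F^{-1}X$ consists of the objects $A$ with $FA=X$. For $f:X\to Y$ in $\mathcal{C}$, $A\in F^{-1}X$, $B\in F^{-1}Y$, write $A\leq_f B$ if there is an $\mathcal{A}$-morphism $\alpha:A\to B$ with $F\alpha=f$; $\leq_X$ (or $\leq$) means $\leq_{1_X}$, a partial order on $F^{-1}X$. The object $f.A\in F^{-1}Y$ is the codomain of a cocartesian lifting of $f$ at $A$: $A\leq_f f.A$, and for all $C\in\mathcal{A}$ and $g:Y\to FC$, $f.A\leq_g C\Leftrightarrow A\leq_{g\circ f}C$. Dually, $B.f\in F^{-1}X$ is the domain of a cartesian lifting of $f$ at $B$: $B.f\leq_f B$, and for all $C\in\mathcal{A}$ and $g:FC\to X$, $C\leq_g B.f\Leftrightarrow C\leq_{f\circ g}B$. An interior operator on $F$ is a family of maps $I_X:F^{-1}X\to F^{-1}X$ ($X\in\mathcal{C}$) such that (I1) $I_X(A)\leq A$; (I2) $A\leq B\Rightarrow I_X(A)\leq I_X(B)$ for $A,B\in F^{-1}X$; (I3) for every $f:X\to Y$ in $\mathcal{C}$ and $B\in F^{-1}Y$, $I_Y(B).f\leq I_X(B.f)$. $\mathrm{Int}(F)$ is the collection of these, ordered by $I\leq I'$ iff $I_X(A)\leq I'_X(A)$ for all $X$, $A$. $I$ is idempotent if $I_X(I_X(A))=I_X(A)$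 for all $X,A$. A topogenous order $\sqsubset$ on $F$ is a family of binary relations $\sqsubset_X$ on $F^{-1}X$ ($X\in\mathcal{C}$) with (T1) $A\sqsubset_X B\Rightarrow A\leq_X B$; (T2) $A'\leq_X A\sqsubset_X B\leq_X B'\Rightarrow A'\sqsubset_X B'$; (T3) for every $f:X\to Y$ in $\mathcal{C}$, $A\in F^{-1}X$, $B\in F^{-1}Y$: $f.A\sqsubset_Y B\Rightarrow A\sqsubset_X B.f$. They are ordered by $\sqsubset\subseteq\sqsubset'$ iff $A\sqsubset_X B\Rightarrow A\sqsubset'_X B$ for all $X,A,B$. $\sqsubset$ is interpolative if $A\sqsubset_X B$ implies $A\sqsubset_X D\sqsubset_X B$ for some $D\in F^{-1}X$. Condition $(TJ)$: for every family $(A_i)_{i\in I}$ in $F^{-1}X$ (possibly empty) whose join exists, if $A_i\sqsubset_X B$ for all $i\in I$ then $\bigvee A_i\sqsubset_X B$. $\mathrm{JTORD}(F)$ is the collection of topogenous orders on $F$ satisfying $(TJ)$, with the order $\subseteq$. *)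

theory Defs
  imports "HOL-Algebra.Complete_Lattice"
begin

section \<open>Categories and forms\<close>

record ('o, 'm) category =
  Obj   :: "'o set"
  Mor   :: "'m set"
  Dom   :: "'m \<Rightarrow> 'o"
  Cod   :: "'m \<Rightarrow> 'o"
  Ident :: "'o \<Rightarrow> 'm"
  Comp  :: "'m \<Rightarrow> 'm \<Rightarrow> 'm"  (infixr \<open>\<cdot>\<index>\<close> 70)

definition Hom :: "('o, 'm) category \<Rightarrow> 'o \<Rightarrow> 'o \<Rightarrow> 'm set"
  where "Hom C X Y = {f \<in> Mor C. Dom C f = X \<and> Cod C f = Y}"

locale category =
  fixes C :: "('o, 'm) category" (structure)
  assumes Dom_in: "f \<in> Mor C \<Longrightarrow> Dom C f \<in> Obj C"
    and Cod_in: "f \<in> Mor C \<Longrightarrow> Cod C f \<in> Obj C"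
    and Ident_in: "X \<in> Obj C \<Longrightarrow> Ident C X \<in> Hom C X X"
    and Comp_in: "\<lbrakk>f \<in> Hom C X Y; g \<in> Hom C Y Z\<rbrakk> \<Longrightarrow> g \<cdot> f \<in> Hom C X Z"
    and Comp_Ident_right: "f \<in> Hom C X Y \<Longrightarrow> f \<cdot> Ident C X = f"
    and Comp_Ident_left: "f \<in> Hom C X Y \<Longrightarrow> Ident C Y \<cdot> f = f"
    and Comp_assoc: "\<lbrakk>f \<in> Hom C W X; g \<in> Hom C X Y; h \<in> Hom C Y Z\<rbrakk>
      \<Longrightarrow> (h \<cdot> g) \<cdot> f = h \<cdot> (g \<cdot> f)"

definition is_isomorphism :: "('o, 'm) category \<Rightarrow> 'm \<Rightarrow> bool"
  where "is_isomorphism C h \<longleftrightarrow> h \<in> Mor C \<and>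
    (\<exists>k \<in> Hom C (Cod C h) (Dom C h).
      k \<cdot>\<^bsub>C\<^esub> h = Ident C (Dom C h) \<and> h \<cdot>\<^bsub>C\<^esub> k = Ident C (Cod C h))"

record ('ao, 'am, 'co, 'cm) cat_functor =
  Src   :: "('ao, 'am) category"
  Tgt   :: "('co, 'cm) category"
  on_Ob :: "'ao \<Rightarrow> 'co"
  on_Mor :: "'am \<Rightarrow> 'cm"

locale cat_functor =
  src: category "Src F" + tgt: category "Tgt F"
  for F :: "('ao, 'am, 'co, 'cm) cat_functor" +
  assumes on_Ob_in: "A \<in> Obj (Src F) \<Longrightarrow> on_Ob F A \<in> Obj (Tgt F)"
    and on_Mor_in: "h \<in> Hom (Src F) A B \<Longrightarrow> on_Mor F h \<in> Hom (Tgt F) (on_Ob F A) (on_Ob F B)"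
    and on_Mor_Ident: "A \<in> Obj (Src F) \<Longrightarrow> on_Mor F (Ident (Src F) A) = Ident (Tgt F) (on_Ob F A)"
    and on_Mor_Comp: "\<lbrakk>h \<in> Hom (Src F) A B; k \<in> Hom (Src F) B D\<rbrakk>
      \<Longrightarrow> on_Mor F (k \<cdot>\<^bsub>Src F\<^esub> h) = on_Mor F k \<cdot>\<^bsub>Tgt F\<^esub> on_Mor F h"

locale form = cat_functor +
  assumes faithful: "\<lbrakk>h \<in> Hom (Src F) A B; k \<in> Hom (Src F) A B; on_Mor F h = on_Mor F k\<rbrakk> \<Longrightarrow> h = k"
    and amnestic: "\<lbrakk>is_isomorphism (Src F) h; h \<in> Hom (Src F) A B;
        on_Mor F h = Ident (Tgt F) (on_Ob F A)\<rbrakk> \<Longrightarrow> A = B \<and> h = Ident (Src F) A"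

definition fibre :: "('ao, 'am, 'co, 'cm) cat_functor \<Rightarrow> 'co \<Rightarrow> 'ao set"
  where "fibre F X = {A \<in> Obj (Src F). on_Ob F A = X}"

definition le_over :: "('ao, 'am, 'co, 'cm) cat_functor \<Rightarrow> 'cm \<Rightarrow> 'ao \<Rightarrow> 'ao \<Rightarrow> bool"
  where "le_over F f A B \<longleftrightarrow> (\<exists>\<alpha> \<in> Hom (Src F) A B. on_Mor F \<alpha> = f)"

definition fibre_order :: "('ao, 'am, 'co, 'cm) cat_functor \<Rightarrow> 'co \<Rightarrow> 'ao gorder"
  where "fibre_order F X =
    \<lparr>carrier = fibre F X, eq = (=), le = le_over F (Ident (Tgt F) X)\<rparr>"

text \<open>\<open>is_push F f A D\<close> says that \<open>D\<close> is \<open>f.A\<close>, and \<open>is_pull F B f D\<close> that \<open>D\<close> is \<open>B.f\<close>.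
  In a form there is at most one such \<open>D\<close> (lemmas \<open>is_push_unique\<close> and \<open>is_pull_unique\<close> below).\<close>

definition is_push :: "('ao, 'am, 'co, 'cm) cat_functor \<Rightarrow> 'cm \<Rightarrow> 'ao \<Rightarrow> 'ao \<Rightarrow> bool"
  where "is_push F f A D \<longleftrightarrow>
    D \<in> fibre F (Cod (Tgt F) f) \<and> le_over F f A D \<and>
    (\<forall>E \<in> Obj (Src F). \<forall>g \<in> Hom (Tgt F) (Cod (Tgt F) f) (on_Ob F E).
      le_over F g D E \<longleftrightarrow> le_over F (g \<cdot>\<^bsub>Tgt F\<^esub> f) A E)"

definition push :: "('ao, 'am, 'co, 'cm) cat_functor \<Rightarrow> 'cm \<Rightarrow> 'ao \<Rightarrow> 'ao"
  where "push F f A = (THE D. is_push F f A D)"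

definition is_pull :: "('ao, 'am, 'co, 'cm) cat_functor \<Rightarrow> 'ao \<Rightarrow> 'cm \<Rightarrow> 'ao \<Rightarrow> bool"
  where "is_pull F B f D \<longleftrightarrow>
    D \<in> fibre F (Dom (Tgt F) f) \<and> le_over F f D B \<and>
    (\<forall>E \<in> Obj (Src F). \<forall>g \<in> Hom (Tgt F) (on_Ob F E) (Dom (Tgt F) f).
      le_over F g E D \<longleftrightarrow> le_over F (f \<cdot>\<^bsub>Tgt F\<^esub> g) E B)"

definition pull :: "('ao, 'am, 'co, 'cm) cat_functor \<Rightarrow> 'ao \<Rightarrow> 'cm \<Rightarrow> 'ao"
  where "pull F B f = (THE D. is_pull F B f D)"

context form
begin

lemma fibre_antisym:
  assumes A: "A \<in> fibre F X" and B: "B \<in> fibre F X"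
    and AB: "le_over F (Ident (Tgt F) X) A B" and BA: "le_over F (Ident (Tgt F) X) B A"
  shows "A = B"
proof -
  obtain a b where a: "a \<in> Hom (Src F) A B" "on_Mor F a = Ident (Tgt F) X"
    and b: "b \<in> Hom (Src F) B A" "on_Mor F b = Ident (Tgt F) X"
    using AB BA unfolding le_over_def by blast
  have obs: "A \<in> Obj (Src F)" "B \<in> Obj (Src F)" "on_Ob F A = X" "on_Ob F B = X"
    using A B unfolding fibre_def by auto
  then have idX: "Ident (Tgt F) X \<cdot>\<^bsub>Tgt F\<^esub> Ident (Tgt F) X = Ident (Tgt F) X"
    using on_Ob_in tgt.Ident_in tgt.Comp_Ident_left by blast
  have "b \<cdot>\<^bsub>Src F\<^esub> a = Ident (Src F) A"
    by (rule faithful[OF src.Comp_in[OF a(1) b(1)] src.Ident_in[OF obs(1)]])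
       (simp add: on_Mor_Comp[OF a(1) b(1)] on_Mor_Ident obs a b idX)
  moreover have "a \<cdot>\<^bsub>Src F\<^esub> b = Ident (Src F) B"
    by (rule faithful[OF src.Comp_in[OF b(1) a(1)] src.Ident_in[OF obs(2)]])
       (simp add: on_Mor_Comp[OF b(1) a(1)] on_Mor_Ident obs a b idX)
  ultimately have "is_isomorphism (Src F) a"
    using a(1) b(1) unfolding is_isomorphism_def Hom_def by auto
  then show ?thesis
    using amnestic a obs by blast
qed

lemma partial_order_fibre: "partial_order (fibre_order F X)"
proof
  fix A assume "A \<in> carrier (fibre_order F X)"
  then show "A \<sqsubseteq>\<^bsub>fibre_order F X\<^esub> A"
    using src.Ident_in on_Mor_Ident by (auto simp: fibre_order_def fibre_def le_over_def)
next
  fix A B D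
  assume *: "A \<sqsubseteq>\<^bsub>fibre_order F X\<^esub> B" "B \<sqsubseteq>\<^bsub>fibre_order F X\<^esub> D" "A \<in> carrier (fibre_order F X)"
  then obtain a b where "a \<in> Hom (Src F) A B" "on_Mor F a = Ident (Tgt F) X"
    "b \<in> Hom (Src F) B D" "on_Mor F b = Ident (Tgt F) X"
    by (auto simp: fibre_order_def le_over_def)
  moreover have "X \<in> Obj (Tgt F)"
    using * on_Ob_in by (auto simp: fibre_order_def fibre_def)
  ultimately show "A \<sqsubseteq>\<^bsub>fibre_order F X\<^esub> D"
    unfolding fibre_order_def le_over_def
    by (auto intro!: bexI[of _ "b \<cdot>\<^bsub>Src F\<^esub> a"] src.Comp_in
        simp: on_Mor_Comp tgt.Comp_Ident_left[OF tgt.Ident_in])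
qed (auto simp: fibre_order_def intro: fibre_antisym)

lemma is_push_unique:
  assumes f: "f \<in> Mor (Tgt F)" and D: "is_push F f A D" and D': "is_push F f A D'"
  shows "D = D'"
proof -
  let ?Y = "Cod (Tgt F) f"
  have f': "f \<in> Hom (Tgt F) (Dom (Tgt F) f) ?Y"
    using f by (simp add: Hom_def)
  have i: "Ident (Tgt F) ?Y \<in> Hom (Tgt F) ?Y ?Y"
    using f tgt.Cod_in tgt.Ident_in by blast
  have "le_over F (Ident (Tgt F) ?Y) D D'" "le_over F (Ident (Tgt F) ?Y) D' D"
    using D D' i tgt.Comp_Ident_left[OF f'] unfolding is_push_def fibre_def by auto
  then show ?thesis
    using fibre_antisym D D' unfolding is_push_def by blast
qed

lemma is_pull_unique:
  assumes f: "f \<in> Mor (Tgt F)" and D: "is_pull F B f D" and D': "is_pull F B f D'"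
  shows "D = D'"
proof -
  let ?X = "Dom (Tgt F) f"
  have f': "f \<in> Hom (Tgt F) ?X (Cod (Tgt F) f)"
    using f by (simp add: Hom_def)
  have i: "Ident (Tgt F) ?X \<in> Hom (Tgt F) ?X ?X"
    using f tgt.Dom_in tgt.Ident_in by blast
  have "le_over F (Ident (Tgt F) ?X) D D'" "le_over F (Ident (Tgt F) ?X) D' D"
    using D D' i tgt.Comp_Ident_right[OF f'] unfolding is_pull_def fibre_def by auto
  then show ?thesis
    using fibre_antisym D D' unfolding is_pull_def by blast
qed

end

section \<open>Interior operators\<close>

text \<open>A family indexed by the objects of the base category is encoded as an extensional function
  (\<open>\<Pi>\<^sub>E\<close>), so that HOL equality of encodings is equality of families.\<close>

locale interior_operator =
  fixes F :: "('ao, 'am, 'co, 'cm) cat_functor" and I :: "'co \<Rightarrow> 'ao \<Rightarrow> 'ao"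
  assumes family: "I \<in> (\<Pi>\<^sub>E X \<in> Obj (Tgt F). fibre F X \<rightarrow>\<^sub>E fibre F X)"
    and I1: "\<lbrakk>X \<in> Obj (Tgt F); A \<in> fibre F X\<rbrakk> \<Longrightarrow> I X A \<sqsubseteq>\<^bsub>fibre_order F X\<^esub> A"
    and I2: "\<lbrakk>X \<in> Obj (Tgt F); A \<in> fibre F X; B \<in> fibre F X; A \<sqsubseteq>\<^bsub>fibre_order F X\<^esub> B\<rbrakk>
      \<Longrightarrow> I X A \<sqsubseteq>\<^bsub>fibre_order F X\<^esub> I X B"
    and I3: "\<lbrakk>f \<in> Hom (Tgt F) X Y; B \<in> fibre F Y\<rbrakk>
      \<Longrightarrow> pull F (I Y B) f \<sqsubseteq>\<^bsub>fibre_order F X\<^esub> I X (pull F B f)"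

definition IntOp :: "('ao, 'am, 'co, 'cm) cat_functor \<Rightarrow> ('co \<Rightarrow> 'ao \<Rightarrow> 'ao) gorder"
  where "IntOp F =
    \<lparr>carrier = {I. interior_operator F I}, eq = (=),
     le = (\<lambda>I I'. \<forall>X \<in> Obj (Tgt F). \<forall>A \<in> fibre F X. I X A \<sqsubseteq>\<^bsub>fibre_order F X\<^esub> I' X A)\<rparr>"

definition idempotent_family :: "('ao, 'am, 'co, 'cm) cat_functor \<Rightarrow> ('co \<Rightarrow> 'ao \<Rightarrow> 'ao) \<Rightarrow> bool"
  where "idempotent_family F I \<longleftrightarrow> (\<forall>X \<in> Obj (Tgt F). \<forall>A \<in> fibre F X. I X (I X A) = I X A)"

section \<open>Topogenous orders\<close>

locale topogenous_order =
  fixes F :: "('ao, 'am, 'co, 'cm) cat_functor" and R :: "'co \<Rightarrow> 'ao rel"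
  assumes family: "R \<in> (\<Pi>\<^sub>E X \<in> Obj (Tgt F). Pow (fibre F X \<times> fibre F X))"
    and T1: "\<lbrakk>X \<in> Obj (Tgt F); (A, B) \<in> R X\<rbrakk> \<Longrightarrow> A \<sqsubseteq>\<^bsub>fibre_order F X\<^esub> B"
    and T2: "\<lbrakk>X \<in> Obj (Tgt F); A' \<in> fibre F X; B' \<in> fibre F X;
        A' \<sqsubseteq>\<^bsub>fibre_order F X\<^esub> A; (A, B) \<in> R X; B \<sqsubseteq>\<^bsub>fibre_order F X\<^esub> B'\<rbrakk> \<Longrightarrow> (A', B') \<in> R X"
    and T3: "\<lbrakk>f \<in> Hom (Tgt F) X Y; A \<in> fibre F X; B \<in> fibre F Y; (push F f A, B) \<in> R Y\<rbrakk>
      \<Longrightarrow> (A, pull F B f) \<in> R X"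

definition interpolative :: "('ao, 'am, 'co, 'cm) cat_functor \<Rightarrow> ('co \<Rightarrow> 'ao rel) \<Rightarrow> bool"
  where "interpolative F R \<longleftrightarrow>
    (\<forall>X \<in> Obj (Tgt F). \<forall>A B. (A, B) \<in> R X \<longrightarrow> (\<exists>D \<in> fibre F X. (A, D) \<in> R X \<and> (D, B) \<in> R X))"

text \<open>The join of a family depends only on its set of members, so (TJ) ranges over the
  subsets \<open>S\<close> of the fibre, the empty set included.\<close>

definition TJ :: "('ao, 'am, 'co, 'cm) cat_functor \<Rightarrow> ('co \<Rightarrow> 'ao rel) \<Rightarrow> bool"
  where "TJ F R \<longleftrightarrow>
    (\<forall>X \<in> Obj (Tgt F). \<forall>S \<subseteq> fibre F X. \<forall>B \<in> fibre F X. \<forall>J.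
      is_lub (fibre_order F X) J S \<and> (\<forall>A \<in> S. (A, B) \<in> R X) \<longrightarrow> (J, B) \<in> R X)"

definition JTORD :: "('ao, 'am, 'co, 'cm) cat_functor \<Rightarrow> ('co \<Rightarrow> 'ao rel) gorder"
  where "JTORD F =
    \<lparr>carrier = {R. topogenous_order F R \<and> TJ F R}, eq = (=),
     le = (\<lambda>R R'. \<forall>X \<in> Obj (Tgt F). R X \<subseteq> R' X)\<rparr>"

section \<open>The correspondence\<close>

definition order_of_interior ::
    "('ao, 'am, 'co, 'cm) cat_functor \<Rightarrow> ('co \<Rightarrow> 'ao \<Rightarrow> 'ao) \<Rightarrow> ('co \<Rightarrow> 'ao rel)"
  where "order_of_interior F I = (\<lambda>X \<in> Obj (Tgt F).
    {(A, B). A \<in> fibre F X \<and> B \<in> fibre F X \<and> A \<sqsubseteq>\<^bsub>fibre_order F X\<^esub> I X B})"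

definition interior_of_order ::
    "('ao, 'am, 'co, 'cm) cat_functor \<Rightarrow> ('co \<Rightarrow> 'ao rel) \<Rightarrow> ('co \<Rightarrow> 'ao \<Rightarrow> 'ao)"
  where "interior_of_order F R = (\<lambda>X \<in> Obj (Tgt F). \<lambda>B \<in> fibre F X.
    \<Squnion>\<^bsub>fibre_order F X\<^esub> {A \<in> fibre F X. (A, B) \<in> R X})"

end

theory Submission
  imports Defs
begin

text \<open>
  Two facts carry the correspondence. In a fibre that is a complete lattice, a relation satisfying
  (T1), (T2) and (TJ) is determined, for each right-hand argument \<open>B\<close>, by a single element: the set
  of all \<open>A\<close> with \<open>A \<sqsubset> B\<close> is a down-set closed under joins, hence the principal down-set of its own
  join \<open>I(B)\<close> (lemma \<open>rel_iff_le_interior\<close>). So \<open>A \<sqsubset> B\<close> and \<open>A \<le> I(B)\<close> say the same thing, and under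
  this reading (T1) and (T2) become (I1) and (I2), containment of relations becomes the pointwise
  order, and the two assignments undo each other.

  The remaining axioms (T3) and (I3) correspond because direct and inverse image along \<open>f\<close> form a
  Galois connection, \<open>f.A \<le> B\<close> iff \<open>A \<le> B.f\<close> (lemma \<open>push_le_iff_le_pull\<close>). Given (I3),
  \<open>f.A \<le> I(B)\<close> transposes to \<open>A \<le> I(B).f \<le> I(B.f)\<close>. Given (T3), the counit
  \<open>f.(I(B).f) \<le> I(B) \<sqsubset> B\<close> yields \<open>I(B).f \<sqsubset> B.f\<close>.

  Interpolation is tested on the largest element below \<open>B\<close>: an element \<open>D\<close> with \<open>I(B) \<sqsubset> D \<sqsubset> B\<close>
  satisfies \<open>D \<le> I(B)\<close>, which forces \<open>I(B) \<le> I(I(B))\<close>; conversely \<open>I(B)\<close> itself interpolates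
  whenever \<open>I\<close> is idempotent.
\<close>

section \<open>Fibres, direct and inverse images\<close>

locale complete_bifibred_form = form +
  assumes push_exists: "\<lbrakk>f \<in> Hom (Tgt F) X Y; A \<in> fibre F X\<rbrakk> \<Longrightarrow> \<exists>D. is_push F f A D"
    and pull_exists: "\<lbrakk>f \<in> Hom (Tgt F) X Y; B \<in> fibre F Y\<rbrakk> \<Longrightarrow> \<exists>D. is_pull F B f D"
    and fibre_complete: "X \<in> Obj (Tgt F) \<Longrightarrow> complete_lattice (fibre_order F X)"
begin

lemma carrier_fibre_order [simp]: "carrier (fibre_order F X) = fibre F X"
  by (simp add: fibre_order_def)

lemma fibre_refl: "A \<in> fibre F X \<Longrightarrow> A \<sqsubseteq>\<^bsub>fibre_order F X\<^esub> A"
  using weak_partial_order.le_refl[OF partial_order.axioms(1)[OF partial_order_fibre], of A X] by simp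

lemma fibre_trans:
  "\<lbrakk>A \<sqsubseteq>\<^bsub>fibre_order F X\<^esub> B; B \<sqsubseteq>\<^bsub>fibre_order F X\<^esub> D;
    A \<in> fibre F X; B \<in> fibre F X; D \<in> fibre F X\<rbrakk> \<Longrightarrow> A \<sqsubseteq>\<^bsub>fibre_order F X\<^esub> D"
  using weak_partial_order.le_trans[OF partial_order.axioms(1)[OF partial_order_fibre], of X A B D]
  by simp

lemma fibre_le_antisym:
  "\<lbrakk>A \<sqsubseteq>\<^bsub>fibre_order F X\<^esub> B; B \<sqsubseteq>\<^bsub>fibre_order F X\<^esub> A; A \<in> fibre F X; B \<in> fibre F X\<rbrakk> \<Longrightarrow> A = B"
  using fibre_antisym by (simp add: fibre_order_def)

lemma Hom_Obj:
  assumes "f \<in> Hom (Tgt F) X Y"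
  shows "X \<in> Obj (Tgt F)" "Y \<in> Obj (Tgt F)"
  using assms tgt.Dom_in tgt.Cod_in by (auto simp: Hom_def)

lemma is_push_push:
  assumes "f \<in> Hom (Tgt F) X Y" "A \<in> fibre F X"
  shows "is_push F f A (push F f A)"
proof -
  have "f \<in> Mor (Tgt F)"
    using assms by (simp add: Hom_def)
  then have "\<exists>!D. is_push F f A D"
    using push_exists[OF assms] is_push_unique by blast
  then show ?thesis
    unfolding push_def by (rule theI')
qed

lemma is_pull_pull:
  assumes "f \<in> Hom (Tgt F) X Y" "B \<in> fibre F Y"
  shows "is_pull F B f (pull F B f)"
proof -
  have "f \<in> Mor (Tgt F)"
    using assms by (simp add: Hom_def)
  then have "\<exists>!D. is_pull F B f D"
    using pull_exists[OF assms] is_pull_unique by blast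
  then show ?thesis
    unfolding pull_def by (rule theI')
qed

lemma push_in_fibre: "\<lbrakk>f \<in> Hom (Tgt F) X Y; A \<in> fibre F X\<rbrakk> \<Longrightarrow> push F f A \<in> fibre F Y"
  using is_push_push[of f X Y A] by (auto simp: is_push_def Hom_def)

lemma pull_in_fibre: "\<lbrakk>f \<in> Hom (Tgt F) X Y; B \<in> fibre F Y\<rbrakk> \<Longrightarrow> pull F B f \<in> fibre F X"
  using is_pull_pull[of f X Y B] by (auto simp: is_pull_def Hom_def)

text \<open>Both inequalities are equivalent to \<open>A \<le>\<^sub>f B\<close>: factor \<open>f\<close> through an identity on the one side
  or on the other in the universal properties of the two liftings.\<close>

lemma push_le_iff_le_pull:
  assumes f: "f \<in> Hom (Tgt F) X Y" and A: "A \<in> fibre F X" and B: "B \<in> fibre F Y"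
  shows "push F f A \<sqsubseteq>\<^bsub>fibre_order F Y\<^esub> B \<longleftrightarrow> A \<sqsubseteq>\<^bsub>fibre_order F X\<^esub> pull F B f"
proof -
  have XY: "Dom (Tgt F) f = X" "Cod (Tgt F) f = Y"
    using f by (auto simp: Hom_def)
  have AB: "A \<in> Obj (Src F)" "on_Ob F A = X" "B \<in> Obj (Src F)" "on_Ob F B = Y"
    using A B by (auto simp: fibre_def)
  have "push F f A \<sqsubseteq>\<^bsub>fibre_order F Y\<^esub> B \<longleftrightarrow> le_over F (Ident (Tgt F) Y \<cdot>\<^bsub>Tgt F\<^esub> f) A B"
    using is_push_push[OF f A] AB XY tgt.Ident_in[OF Hom_Obj(2)[OF f]]
    by (auto simp: is_push_def fibre_order_def)
  also have "\<dots> \<longleftrightarrow> le_over F (f \<cdot>\<^bsub>Tgt F\<^esub> Ident (Tgt F) X) A B"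
    using f by (simp add: tgt.Comp_Ident_left tgt.Comp_Ident_right)
  also have "\<dots> \<longleftrightarrow> A \<sqsubseteq>\<^bsub>fibre_order F X\<^esub> pull F B f"
    using is_pull_pull[OF f B] AB XY tgt.Ident_in[OF Hom_Obj(1)[OF f]]
    by (auto simp: is_pull_def fibre_order_def)
  finally show ?thesis .
qed

section \<open>From interior operators to topogenous orders\<close>

lemma order_of_interior_iff:
  "X \<in> Obj (Tgt F) \<Longrightarrow> (A, B) \<in> order_of_interior F I X \<longleftrightarrow>
    A \<in> fibre F X \<and> B \<in> fibre F X \<and> A \<sqsubseteq>\<^bsub>fibre_order F X\<^esub> I X B"
  by (simp add: order_of_interior_def)

lemma interior_in_fibre:
  "\<lbrakk>interior_operator F I; X \<in> Obj (Tgt F); B \<in> fibre F X\<rbrakk> \<Longrightarrow> I X B \<in> fibre F X"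
  by (rule PiE_mem[OF PiE_mem[OF interior_operator.family]])

lemma topogenous_order_of_interior:
  assumes I: "interior_operator F I"
  shows "topogenous_order F (order_of_interior F I)"
proof
  show "order_of_interior F I \<in> (\<Pi>\<^sub>E X \<in> Obj (Tgt F). Pow (fibre F X \<times> fibre F X))"
    by (auto simp: order_of_interior_def)
next
  fix X A B
  assume X: "X \<in> Obj (Tgt F)" and "(A, B) \<in> order_of_interior F I X"
  then have AB: "A \<in> fibre F X" "B \<in> fibre F X" "A \<sqsubseteq>\<^bsub>fibre_order F X\<^esub> I X B"
    by (simp_all add: order_of_interior_iff)
  show "A \<sqsubseteq>\<^bsub>fibre_order F X\<^esub> B"
    by (rule fibre_trans[OF AB(3) interior_operator.I1[OF I X AB(2)] AB(1)
          interior_in_fibre[OF I X AB(2)] AB(2)])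
next
  fix X A A' B B'
  assume X: "X \<in> Obj (Tgt F)" and A': "A' \<in> fibre F X" and B': "B' \<in> fibre F X"
    and A'A: "A' \<sqsubseteq>\<^bsub>fibre_order F X\<^esub> A" and R: "(A, B) \<in> order_of_interior F I X"
    and BB': "B \<sqsubseteq>\<^bsub>fibre_order F X\<^esub> B'"
  have AB: "A \<in> fibre F X" "B \<in> fibre F X" "A \<sqsubseteq>\<^bsub>fibre_order F X\<^esub> I X B"
    using R X by (simp_all add: order_of_interior_iff)
  have "I X B \<sqsubseteq>\<^bsub>fibre_order F X\<^esub> I X B'"
    by (rule interior_operator.I2[OF I X AB(2) B' BB'])
  then have "A \<sqsubseteq>\<^bsub>fibre_order F X\<^esub> I X B'"
    by (rule fibre_trans[OF AB(3) _ AB(1) interior_in_fibre[OF I X AB(2)]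
          interior_in_fibre[OF I X B']])
  then have "A' \<sqsubseteq>\<^bsub>fibre_order F X\<^esub> I X B'"
    by (rule fibre_trans[OF A'A _ A' AB(1) interior_in_fibre[OF I X B']])
  then show "(A', B') \<in> order_of_interior F I X"
    using X A' B' by (simp add: order_of_interior_iff)
next
  fix f X Y A B
  assume f: "f \<in> Hom (Tgt F) X Y" and A: "A \<in> fibre F X" and B: "B \<in> fibre F Y"
    and R: "(push F f A, B) \<in> order_of_interior F I Y"
  note X = Hom_Obj(1)[OF f] and Y = Hom_Obj(2)[OF f]
  note IB = interior_in_fibre[OF I Y B] and Bf = pull_in_fibre[OF f B]
  have "push F f A \<sqsubseteq>\<^bsub>fibre_order F Y\<^esub> I Y B"
    using R Y by (simp add: order_of_interior_iff)
  then have "A \<sqsubseteq>\<^bsub>fibre_order F X\<^esub> pull F (I Y B) f"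
    using push_le_iff_le_pull[OF f A IB] by simp
  then have "A \<sqsubseteq>\<^bsub>fibre_order F X\<^esub> I X (pull F B f)"
    by (rule fibre_trans[OF _ interior_operator.I3[OF I f B] A pull_in_fibre[OF f IB]
          interior_in_fibre[OF I X Bf]])
  then show "(A, pull F B f) \<in> order_of_interior F I X"
    using X A Bf by (simp add: order_of_interior_iff)
qed

lemma TJ_order_of_interior:
  assumes I: "interior_operator F I"
  shows "TJ F (order_of_interior F I)"
  unfolding TJ_def
proof (intro ballI allI impI)
  fix X S B J
  assume X: "X \<in> Obj (Tgt F)" and S: "S \<subseteq> fibre F X" and B: "B \<in> fibre F X"
    and "is_lub (fibre_order F X) J S \<and> (\<forall>A\<in>S. (A, B) \<in> order_of_interior F I X)"
  then have J: "is_lub (fibre_order F X) J S" and R: "\<forall>A\<in>S. A \<sqsubseteq>\<^bsub>fibre_order F X\<^esub> I X B"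
    by (auto simp: order_of_interior_iff)
  have "I X B \<in> Upper (fibre_order F X) S"
    using R S interior_in_fibre[OF I X B] by (auto simp: Upper_def)
  then show "(J, B) \<in> order_of_interior F I X"
    using J X B by (auto simp: order_of_interior_iff least_def Upper_def)
qed

section \<open>From topogenous orders to interior operators\<close>

lemma fibre_sup_is_lub:
  assumes X: "X \<in> Obj (Tgt F)" and S: "S \<subseteq> fibre F X"
  shows "is_lub (fibre_order F X) (\<Squnion>\<^bsub>fibre_order F X\<^esub> S) S"
proof -
  obtain J where "is_lub (fibre_order F X) J S"
    using complete_lattice.sup_exists[OF fibre_complete[OF X]] S by auto
  then show ?thesis
    unfolding sup_def by (rule someI)
qed

lemma interior_of_order_is_lub:
  assumes "X \<in> Obj (Tgt F)" "B \<in> fibre F X"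
  shows "is_lub (fibre_order F X) (interior_of_order F R X B) {A \<in> fibre F X. (A, B) \<in> R X}"
  using fibre_sup_is_lub[OF assms(1), of "{A \<in> fibre F X. (A, B) \<in> R X}"] assms
  by (simp add: interior_of_order_def)

lemma interior_of_order_in_fibre:
  "\<lbrakk>X \<in> Obj (Tgt F); B \<in> fibre F X\<rbrakk> \<Longrightarrow> interior_of_order F R X B \<in> fibre F X"
  using interior_of_order_is_lub[of X B R] by (auto simp: least_def Upper_def)

lemma topogenous_order_in_fibre:
  "\<lbrakk>topogenous_order F R; X \<in> Obj (Tgt F); (A, B) \<in> R X\<rbrakk> \<Longrightarrow> A \<in> fibre F X \<and> B \<in> fibre F X"
  using PiE_mem[OF topogenous_order.family, of F R X] by auto

lemma TJ_lub:
  assumes TJ: "TJ F R" and X: "X \<in> Obj (Tgt F)" and S: "S \<subseteq> fibre F X" and B: "B \<in> fibre F X"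
    and J: "is_lub (fibre_order F X) J S" and R: "\<And>A. A \<in> S \<Longrightarrow> (A, B) \<in> R X"
  shows "(J, B) \<in> R X"
proof -
  have "is_lub (fibre_order F X) J S \<and> (\<forall>A \<in> S. (A, B) \<in> R X)"
    using J R by simp
  with TJ X S B show ?thesis
    unfolding TJ_def by meson
qed

text \<open>Condition (TJ) applied to the whole set \<open>{A. A \<sqsubset> B}\<close>: its join is its largest element.\<close>

lemma interior_of_order_rel:
  assumes "topogenous_order F R" "TJ F R" "X \<in> Obj (Tgt F)" "B \<in> fibre F X"
  shows "(interior_of_order F R X B, B) \<in> R X"
  by (rule TJ_lub[OF assms(2,3) _ assms(4) interior_of_order_is_lub[OF assms(3,4)]]) auto

lemma rel_iff_le_interior:
  assumes R: "topogenous_order F R" "TJ F R" and X: "X \<in> Obj (Tgt F)"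
    and A: "A \<in> fibre F X" and B: "B \<in> fibre F X"
  shows "(A, B) \<in> R X \<longleftrightarrow> A \<sqsubseteq>\<^bsub>fibre_order F X\<^esub> interior_of_order F R X B"
proof
  assume "(A, B) \<in> R X"
  then show "A \<sqsubseteq>\<^bsub>fibre_order F X\<^esub> interior_of_order F R X B"
    using interior_of_order_is_lub[OF X B, of R] A by (auto simp: least_def Upper_def)
next
  assume "A \<sqsubseteq>\<^bsub>fibre_order F X\<^esub> interior_of_order F R X B"
  then show "(A, B) \<in> R X"
    by (rule topogenous_order.T2[OF R(1) X A B _ interior_of_order_rel[OF R X B] fibre_refl[OF B]])
qed

lemma interior_operator_of_order:
  assumes R: "topogenous_order F R" "TJ F R"
  shows "interior_operator F (interior_of_order F R)"
proof
  show "interior_of_order F R \<in> (\<Pi>\<^sub>E X \<in> Obj (Tgt F). fibre F X \<rightarrow>\<^sub>E fibre F X)"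
  proof (rule PiE_I)
    fix X assume "X \<in> Obj (Tgt F)"
    then show "interior_of_order F R X \<in> fibre F X \<rightarrow>\<^sub>E fibre F X"
      using interior_of_order_in_fibre by (auto simp: PiE_iff interior_of_order_def)
  qed (simp add: interior_of_order_def)
next
  fix X A
  assume "X \<in> Obj (Tgt F)" "A \<in> fibre F X"
  then show "interior_of_order F R X A \<sqsubseteq>\<^bsub>fibre_order F X\<^esub> A"
    using topogenous_order.T1[OF R(1)] interior_of_order_rel[OF R] by blast
next
  fix X A B
  assume X: "X \<in> Obj (Tgt F)" and A: "A \<in> fibre F X" and B: "B \<in> fibre F X"
    and AB: "A \<sqsubseteq>\<^bsub>fibre_order F X\<^esub> B"
  note IA = interior_of_order_in_fibre[OF X A, of R]
  have "(interior_of_order F R X A, B) \<in> R X"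
    by (rule topogenous_order.T2[OF R(1) X IA B fibre_refl[OF IA]
          interior_of_order_rel[OF R X A] AB])
  then show "interior_of_order F R X A \<sqsubseteq>\<^bsub>fibre_order F X\<^esub> interior_of_order F R X B"
    using rel_iff_le_interior[OF R X IA B] by simp
next
  fix f X Y B
  assume f: "f \<in> Hom (Tgt F) X Y" and B: "B \<in> fibre F Y"
  note X = Hom_Obj(1)[OF f] and Y = Hom_Obj(2)[OF f]
  let ?D = "interior_of_order F R Y B"
  note D = interior_of_order_in_fibre[OF Y B, of R]
  note Df = pull_in_fibre[OF f D] and Bf = pull_in_fibre[OF f B]
  have "push F f (pull F ?D f) \<sqsubseteq>\<^bsub>fibre_order F Y\<^esub> ?D"
    using push_le_iff_le_pull[OF f Df D] fibre_refl[OF Df] by simp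
  then have "(push F f (pull F ?D f), B) \<in> R Y"
    using rel_iff_le_interior[OF R Y push_in_fibre[OF f Df] B] by simp
  then have "(pull F ?D f, pull F B f) \<in> R X"
    by (rule topogenous_order.T3[OF R(1) f Df B])
  then show "pull F ?D f \<sqsubseteq>\<^bsub>fibre_order F X\<^esub> interior_of_order F R X (pull F B f)"
    using rel_iff_le_interior[OF R X Df Bf] by simp
qed

section \<open>The correspondence\<close>

lemma order_of_interior_of_order:
  assumes R: "topogenous_order F R" "TJ F R"
  shows "order_of_interior F (interior_of_order F R) = R"
proof (rule PiE_ext)
  show "order_of_interior F (interior_of_order F R) \<in>
      (\<Pi>\<^sub>E X \<in> Obj (Tgt F). Pow (fibre F X \<times> fibre F X))"
    by (auto simp: order_of_interior_def)
  show "R \<in> (\<Pi>\<^sub>E X \<in> Obj (Tgt F). Pow (fibre F X \<times> fibre F X))"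
    by (rule topogenous_order.family[OF R(1)])
next
  fix X assume X: "X \<in> Obj (Tgt F)"
  have "(A, B) \<in> order_of_interior F (interior_of_order F R) X \<longleftrightarrow> (A, B) \<in> R X" for A B
    using order_of_interior_iff[OF X, of A B] rel_iff_le_interior[OF R X, of A B]
      topogenous_order_in_fibre[OF R(1) X, of A B] by blast
  then show "order_of_interior F (interior_of_order F R) X = R X"
    by (simp add: set_eq_iff split_paired_all)
qed

text \<open>An element lies below the new \<open>I'(B)\<close> iff it is related to \<open>B\<close>, hence iff it lies below \<open>I(B)\<close>;
  two elements of a poset with the same down-set are equal.\<close>

lemma interior_of_order_of_interior:
  assumes I: "interior_operator F I"
  shows "interior_of_order F (order_of_interior F I) = I" (is "?I' = I")
proof (rule PiE_ext)
  note R = topogenous_order_of_interior[OF I] TJ_order_of_interior[OF I]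
  show "?I' \<in> (\<Pi>\<^sub>E X \<in> Obj (Tgt F). fibre F X \<rightarrow>\<^sub>E fibre F X)"
    by (rule interior_operator.family[OF interior_operator_of_order[OF R]])
  show "I \<in> (\<Pi>\<^sub>E X \<in> Obj (Tgt F). fibre F X \<rightarrow>\<^sub>E fibre F X)"
    by (rule interior_operator.family[OF I])
  fix X assume X: "X \<in> Obj (Tgt F)"
  show "?I' X = I X"
  proof (rule PiE_ext)
    show "?I' X \<in> fibre F X \<rightarrow>\<^sub>E fibre F X"
      using interior_operator.family[OF interior_operator_of_order[OF R]] X by (rule PiE_mem)
    show "I X \<in> fibre F X \<rightarrow>\<^sub>E fibre F X"
      using interior_operator.family[OF I] X by (rule PiE_mem)
    fix B assume B: "B \<in> fibre F X"
    note IB = interior_in_fibre[OF I X B]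
      and I'B = interior_of_order_in_fibre[OF X B, of "order_of_interior F I"]
    \<comment> \<open>The relation of \<open>I\<close> satisfies (TJ), so the description by \<open>I'\<close> applies to it.\<close>
    have below: "A \<sqsubseteq>\<^bsub>fibre_order F X\<^esub> ?I' X B \<longleftrightarrow> A \<sqsubseteq>\<^bsub>fibre_order F X\<^esub> I X B"
      if "A \<in> fibre F X" for A
      using rel_iff_le_interior[OF R X that B] X B that by (simp add: order_of_interior_iff)
    show "?I' X B = I X B"
      using below[OF I'B] below[OF IB] fibre_refl[OF IB] fibre_refl[OF I'B]
        fibre_le_antisym[OF _ _ I'B IB] by simp
  qed
qed

text \<open>Containment of the relations is tested on the pairs \<open>(I(B), B)\<close>, the largest ones related
  for a given \<open>B\<close>.\<close>

lemma order_of_interior_mono_iff: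
  assumes I: "interior_operator F I" and I': "interior_operator F I'"
  shows "(\<forall>X \<in> Obj (Tgt F). order_of_interior F I X \<subseteq> order_of_interior F I' X) \<longleftrightarrow>
    (\<forall>X \<in> Obj (Tgt F). \<forall>A \<in> fibre F X. I X A \<sqsubseteq>\<^bsub>fibre_order F X\<^esub> I' X A)" (is "?L \<longleftrightarrow> ?R")
proof
  assume L: ?L
  show ?R
  proof (intro ballI)
    fix X B assume X: "X \<in> Obj (Tgt F)" and B: "B \<in> fibre F X"
    note IB = interior_in_fibre[OF I X B]
    have "(I X B, B) \<in> order_of_interior F I X"
      using X B IB fibre_refl[OF IB] by (simp add: order_of_interior_iff)
    then have "(I X B, B) \<in> order_of_interior F I' X"
      using L X by blast
    then show "I X B \<sqsubseteq>\<^bsub>fibre_order F X\<^esub> I' X B"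
      using X by (simp add: order_of_interior_iff)
  qed
next
  assume R: ?R
  show ?L
  proof (intro ballI subrelI)
    fix X A B assume X: "X \<in> Obj (Tgt F)" and "(A, B) \<in> order_of_interior F I X"
    then have AB: "A \<in> fibre F X" "B \<in> fibre F X" "A \<sqsubseteq>\<^bsub>fibre_order F X\<^esub> I X B"
      by (simp_all add: order_of_interior_iff)
    have "I X B \<sqsubseteq>\<^bsub>fibre_order F X\<^esub> I' X B"
      using R X AB(2) by blast
    then have "A \<sqsubseteq>\<^bsub>fibre_order F X\<^esub> I' X B"
      by (rule fibre_trans[OF AB(3) _ AB(1) interior_in_fibre[OF I X AB(2)]
            interior_in_fibre[OF I' X AB(2)]])
    then show "(A, B) \<in> order_of_interior F I' X"
      using X AB by (simp add: order_of_interior_iff)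
  qed
qed

lemma weak_partial_order_JTORD: "weak_partial_order (JTORD F)"
proof
  fix R R'
  assume le: "R \<sqsubseteq>\<^bsub>JTORD F\<^esub> R'" "R' \<sqsubseteq>\<^bsub>JTORD F\<^esub> R"
    and "R \<in> carrier (JTORD F)" "R' \<in> carrier (JTORD F)"
  then have "topogenous_order F R" "topogenous_order F R'"
    by (simp_all add: JTORD_def)
  then have "R = R'"
    using le by (intro PiE_ext[OF topogenous_order.family topogenous_order.family])
      (auto simp: JTORD_def)
  then show "R .=\<^bsub>JTORD F\<^esub> R'"
    by (simp add: JTORD_def)
qed (auto simp: JTORD_def)

lemma weak_partial_order_IntOp: "weak_partial_order (IntOp F)"
proof
  fix I assume "I \<in> carrier (IntOp F)"
  then show "I \<sqsubseteq>\<^bsub>IntOp F\<^esub> I"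
    using interior_in_fibre fibre_refl by (simp add: IntOp_def)
next
  fix I I'
  assume le: "I \<sqsubseteq>\<^bsub>IntOp F\<^esub> I'" "I' \<sqsubseteq>\<^bsub>IntOp F\<^esub> I"
    and "I \<in> carrier (IntOp F)" "I' \<in> carrier (IntOp F)"
  then have II': "interior_operator F I" "interior_operator F I'"
    by (simp_all add: IntOp_def)
  have "I X B = I' X B" if X: "X \<in> Obj (Tgt F)" and B: "B \<in> fibre F X" for X B
    by (rule fibre_le_antisym[OF _ _ interior_in_fibre[OF II'(1) X B] interior_in_fibre[OF II'(2) X B]])
      (use le X B in \<open>simp_all add: IntOp_def\<close>)
  then have "I X = I' X" if "X \<in> Obj (Tgt F)" for X
    by (rule PiE_ext[OF PiE_mem[OF interior_operator.family[OF II'(1)] that]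
          PiE_mem[OF interior_operator.family[OF II'(2)] that]]) (use that in simp_all)
  then have "I = I'"
    by (rule PiE_ext[OF interior_operator.family[OF II'(1)] interior_operator.family[OF II'(2)]])
  then show "I .=\<^bsub>IntOp F\<^esub> I'"
    by (simp add: IntOp_def)
next
  fix I I' I''
  assume le: "I \<sqsubseteq>\<^bsub>IntOp F\<^esub> I'" "I' \<sqsubseteq>\<^bsub>IntOp F\<^esub> I''"
    and "I \<in> carrier (IntOp F)" "I' \<in> carrier (IntOp F)" "I'' \<in> carrier (IntOp F)"
  then have mem: "interior_operator F I" "interior_operator F I'" "interior_operator F I''"
    by (simp_all add: IntOp_def)
  have "I X A \<sqsubseteq>\<^bsub>fibre_order F X\<^esub> I'' X A" if X: "X \<in> Obj (Tgt F)" and A: "A \<in> fibre F X" for X A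
    using le X A interior_in_fibre[OF mem(1) X A] interior_in_fibre[OF mem(2) X A]
      interior_in_fibre[OF mem(3) X A] fibre_trans[of X "I X A" "I' X A" "I'' X A"]
    by (simp add: IntOp_def)
  then show "I \<sqsubseteq>\<^bsub>IntOp F\<^esub> I''"
    by (simp add: IntOp_def)
qed (auto simp: IntOp_def)

lemma idempotent_iff_interpolative:
  assumes R: "topogenous_order F R" "TJ F R"
  shows "idempotent_family F (interior_of_order F R) \<longleftrightarrow> interpolative F R"
proof
  let ?I = "interior_of_order F R"
  assume idem: "idempotent_family F ?I"
  show "interpolative F R"
    unfolding interpolative_def
  proof (intro ballI allI impI)
    fix X A B assume X: "X \<in> Obj (Tgt F)" and AB: "(A, B) \<in> R X"
    have A: "A \<in> fibre F X" and B: "B \<in> fibre F X"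
      using topogenous_order_in_fibre[OF R(1) X AB] by auto
    note IB = interior_of_order_in_fibre[OF X B, of R]
    have "A \<sqsubseteq>\<^bsub>fibre_order F X\<^esub> ?I X (?I X B)"
      using AB rel_iff_le_interior[OF R X A B] idem X B by (simp add: idempotent_family_def)
    then have "(A, ?I X B) \<in> R X"
      using rel_iff_le_interior[OF R X A IB] by simp
    then show "\<exists>D \<in> fibre F X. (A, D) \<in> R X \<and> (D, B) \<in> R X"
      using IB interior_of_order_rel[OF R X B] by blast
  qed
next
  let ?I = "interior_of_order F R"
  assume interp: "interpolative F R"
  show "idempotent_family F ?I"
    unfolding idempotent_family_def
  proof (intro ballI)
    fix X B assume X: "X \<in> Obj (Tgt F)" and B: "B \<in> fibre F X"
    note IB = interior_of_order_in_fibre[OF X B, of R]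
    note IIB = interior_of_order_in_fibre[OF X IB, of R]
    obtain D where D: "D \<in> fibre F X" "(?I X B, D) \<in> R X" "(D, B) \<in> R X"
      using interp X interior_of_order_rel[OF R X B] unfolding interpolative_def by blast
    have "D \<sqsubseteq>\<^bsub>fibre_order F X\<^esub> ?I X B"
      using D rel_iff_le_interior[OF R X D(1) B] by simp
    then have "(?I X B, ?I X B) \<in> R X"
      by (rule topogenous_order.T2[OF R(1) X IB IB fibre_refl[OF IB] D(2)])
    then have "?I X B \<sqsubseteq>\<^bsub>fibre_order F X\<^esub> ?I X (?I X B)"
      using rel_iff_le_interior[OF R X IB IB] by simp
    moreover have "?I X (?I X B) \<sqsubseteq>\<^bsub>fibre_order F X\<^esub> ?I X B"
      by (rule interior_operator.I1[OF interior_operator_of_order[OF R] X IB])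
    ultimately show "?I X (?I X B) = ?I X B"
      using fibre_le_antisym IB IIB by blast
  qed
qed

end

theorem proposition3p3:
  fixes F :: "('ao, 'am, 'co, 'cm) cat_functor"
  assumes "form F"
    and "\<And>f X Y A. f \<in> Hom (Tgt F) X Y \<Longrightarrow> A \<in> fibre F X \<Longrightarrow> \<exists>D. is_push F f A D"
    and "\<And>f X Y B. f \<in> Hom (Tgt F) X Y \<Longrightarrow> B \<in> fibre F Y \<Longrightarrow> \<exists>D. is_pull F B f D"
    and "\<And>X. X \<in> Obj (Tgt F) \<Longrightarrow> complete_lattice (fibre_order F X)"
  shows "bij_betw (order_of_interior F) (carrier (IntOp F)) (carrier (JTORD F))
    \<and> order_emb (IntOp F) (JTORD F) (order_of_interior F)
    \<and> bij_betw (interior_of_order F) (carrier (JTORD F)) (carrier (IntOp F))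
    \<and> order_emb (JTORD F) (IntOp F) (interior_of_order F)
    \<and> (\<forall>I \<in> carrier (IntOp F). interior_of_order F (order_of_interior F I) = I)
    \<and> (\<forall>R \<in> carrier (JTORD F). order_of_interior F (interior_of_order F R) = R)
    \<and> (\<forall>R \<in> carrier (JTORD F).
          idempotent_family F (interior_of_order F R) \<longleftrightarrow> interpolative F R)"
proof -
  interpret complete_bifibred_form F
    using assms by (simp add: complete_bifibred_form_def complete_bifibred_form_axioms_def)
  have to_JTORD: "order_of_interior F ` carrier (IntOp F) \<subseteq> carrier (JTORD F)"
    using topogenous_order_of_interior TJ_order_of_interior by (auto simp: IntOp_def JTORD_def)
  have to_IntOp: "interior_of_order F ` carrier (JTORD F) \<subseteq> carrier (IntOp F)"
    using interior_operator_of_order by (auto simp: IntOp_def JTORD_def)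
  have inv_I: "\<forall>I \<in> carrier (IntOp F). interior_of_order F (order_of_interior F I) = I"
    using interior_of_order_of_interior by (simp add: IntOp_def)
  have inv_R: "\<forall>R \<in> carrier (JTORD F). order_of_interior F (interior_of_order F R) = R"
    using order_of_interior_of_order by (simp add: JTORD_def)
  have le_iff: "order_of_interior F I \<sqsubseteq>\<^bsub>JTORD F\<^esub> order_of_interior F I' \<longleftrightarrow> I \<sqsubseteq>\<^bsub>IntOp F\<^esub> I'"
    if "I \<in> carrier (IntOp F)" "I' \<in> carrier (IntOp F)" for I I'
    using order_of_interior_mono_iff[of I I'] that by (simp add: IntOp_def JTORD_def)
  have emb: "order_emb (IntOp F) (JTORD F) (order_of_interior F)"
    using weak_partial_order_IntOp weak_partial_order_JTORD le_iff by (simp add: order_emb_def)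
  \<comment> \<open>Apply the embedding property of the inverse map to the images of \<open>R\<close> and \<open>R'\<close>.\<close>
  have "order_emb (JTORD F) (IntOp F) (interior_of_order F)"
    unfolding order_emb_def
  proof (intro conjI ballI weak_partial_order_IntOp weak_partial_order_JTORD)
    fix R R' assume RR': "R \<in> carrier (JTORD F)" "R' \<in> carrier (JTORD F)"
    then have "interior_of_order F R \<in> carrier (IntOp F)" "interior_of_order F R' \<in> carrier (IntOp F)"
      using to_IntOp by auto
    then show "interior_of_order F R \<sqsubseteq>\<^bsub>IntOp F\<^esub> interior_of_order F R' \<longleftrightarrow> R \<sqsubseteq>\<^bsub>JTORD F\<^esub> R'"
      using le_iff[of "interior_of_order F R" "interior_of_order F R'"] inv_R RR' by simp
  qed
  moreover have "bij_betw (order_of_interior F) (carrier (IntOp F)) (carrier (JTORD F))"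
    by (rule bij_betw_byWitness[OF inv_I inv_R to_JTORD to_IntOp])
  moreover have "bij_betw (interior_of_order F) (carrier (JTORD F)) (carrier (IntOp F))"
    by (rule bij_betw_byWitness[OF inv_R inv_I to_IntOp to_JTORD])
  moreover have "\<forall>R \<in> carrier (JTORD F).
      idempotent_family F (interior_of_order F R) \<longleftrightarrow> interpolative F R"
    using idempotent_iff_interpolative by (simp add: JTORD_def)
  ultimately show ?thesis
    using emb inv_I inv_R by blast
qed

end
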